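(* Let $(L,[-,-,-]_1,[-,-,-]_2)$ be a compatible ternary Leibniz algebra over a field $\mathbb{K}$ and let $\beta:L\to L$ be an injective linear map which is an averaging operator for both $[-,-,-]_1$ and $[-,-,-]_2$. For $i=1,2$ put $[x,y,z]_i^{\beta}:=[\beta(x),\beta(y),z]_i$. Then $L^{\beta}:=(L,[-,-,-]_1^{\beta},[-,-,-]_2^{\beta})$ is a compatible ternary Leibniz algebra. Moreover, with $[-,-,-]:=[-,-,-]_1+[-,-,-]_2$ and $[-,-,-]^{\beta}:=[-,-,-]_1^{\beta}+[-,-,-]_2^{\beta}$, the map $\beta:(L,[-,-,-]^{\beta})\to(L,[-,-,-])$ is a morphism of ternary Leibniz algebras.
   Context: A ternary Leibniz algebra is a vector space $L$ with a trilinear bracket satisfying $[[x,y,z],t,u]=[x,y,[z,t,u]]+[x,[y,t,u],z]+[[x,t,u],y,z]$ for all $x,y,z,t,u\in L$. A morphism of ternary Leibniz algebras is a linear map preserving the brackets. An averaging operator on a ternary Leibniz algebra is a linear map $\beta:L\to L$ with $\beta([\beta(x),\beta(y),z])=\beta([\beta(x),y,\beta(z)])=\beta([x,\beta(y),\beta(z)])=[\beta(x),\beta(y),\beta(z)]$ for all $x,y,z$. A compatible ternary Leibniz algebra is a triple $(L,[-,-,-]_1,[-,-,-]_2)$ such that both brackets are ternary Leibniz and, for all $x,y,z,t,u\in L$, \begin{align*} [[x,y,z]_1,t,u]_2+[[x,y,z]_2,t,u]_1&=[x,y,[z,t,u]_1]_2+[x,y,[z,t,u]_2]_1+[x,[y,t,u]_1,z]_2\\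 &\quad+[x,[y,t,u]_2,z]_1+[[x,t,u]_1,y,z]_2+[[x,t,u]_2,y,z]_1. \end{align*} *)

theory Defs
  imports Complex_Main
begin

definition trilinear ::
    "('k::field \<Rightarrow> 'a::ab_group_add \<Rightarrow> 'a) \<Rightarrow> ('a \<Rightarrow> 'a \<Rightarrow> 'a \<Rightarrow> 'a) \<Rightarrow> bool" where
  "trilinear scale br \<longleftrightarrow>
     (\<forall>y z. Vector_Spaces.linear scale scale (\<lambda>x. br x y z)) \<and>
     (\<forall>x z. Vector_Spaces.linear scale scale (\<lambda>y. br x y z)) \<and>
     (\<forall>x y. Vector_Spaces.linear scale scale (\<lambda>z. br x y z))"

locale ternary_leibniz_algebra = vector_space scale
  for scale :: "'k::field \<Rightarrow> 'a::ab_group_add \<Rightarrow> 'a" +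
  fixes br :: "'a \<Rightarrow> 'a \<Rightarrow> 'a \<Rightarrow> 'a"
  assumes trilinear: "trilinear scale br"
    and leibniz: "br (br x y z) t u = br x y (br z t u) + br x (br y t u) z + br (br x t u) y z"

locale ternary_leibniz_morphism =
  source: ternary_leibniz_algebra scale1 br1 +
  target: ternary_leibniz_algebra scale2 br2 +
  Vector_Spaces.linear scale1 scale2 f
  for scale1 :: "'k::field \<Rightarrow> 'a::ab_group_add \<Rightarrow> 'a"
    and br1 :: "'a \<Rightarrow> 'a \<Rightarrow> 'a \<Rightarrow> 'a"
    and scale2 :: "'k \<Rightarrow> 'b::ab_group_add \<Rightarrow> 'b"
    and br2 :: "'b \<Rightarrow> 'b \<Rightarrow> 'b \<Rightarrow> 'b"
    and f :: "'a \<Rightarrow> 'b" +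
  assumes preserves_bracket: "f (br1 x y z) = br2 (f x) (f y) (f z)"

locale averaging_operator =
  ternary_leibniz_algebra scale br +
  Vector_Spaces.linear scale scale \<beta>
  for scale :: "'k::field \<Rightarrow> 'a::ab_group_add \<Rightarrow> 'a"
    and br :: "'a \<Rightarrow> 'a \<Rightarrow> 'a \<Rightarrow> 'a"
    and \<beta> :: "'a \<Rightarrow> 'a" +
  assumes averaging12: "\<beta> (br (\<beta> x) (\<beta> y) z) = br (\<beta> x) (\<beta> y) (\<beta> z)"
    and averaging13: "\<beta> (br (\<beta> x) y (\<beta> z)) = br (\<beta> x) (\<beta> y) (\<beta> z)"
    and averaging23: "\<beta> (br x (\<beta> y) (\<beta> z)) = br (\<beta> x) (\<beta> y) (\<beta> z)"

locale compatible_ternary_leibniz_algebra =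
  first: ternary_leibniz_algebra scale br1 +
  second: ternary_leibniz_algebra scale br2
  for scale :: "'k::field \<Rightarrow> 'a::ab_group_add \<Rightarrow> 'a"
    and br1 :: "'a \<Rightarrow> 'a \<Rightarrow> 'a \<Rightarrow> 'a"
    and br2 :: "'a \<Rightarrow> 'a \<Rightarrow> 'a \<Rightarrow> 'a" +
  assumes compatible:
    "br2 (br1 x y z) t u + br1 (br2 x y z) t u =
       br2 x y (br1 z t u) + br1 x y (br2 z t u) + br2 x (br1 y t u) z
       + br1 x (br2 y t u) z + br2 (br1 x t u) y z + br1 (br2 x t u) y z"

definition twisted_bracket ::
    "('a \<Rightarrow> 'a) \<Rightarrow> ('a \<Rightarrow> 'a \<Rightarrow> 'a \<Rightarrow> 'a) \<Rightarrow> 'a \<Rightarrow> 'a \<Rightarrow> 'a \<Rightarrow> 'a" where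
  "twisted_bracket \<beta> br x y z = br (\<beta> x) (\<beta> y) z"

definition sum_bracket ::
    "('a \<Rightarrow> 'a \<Rightarrow> 'a \<Rightarrow> 'a::ab_group_add) \<Rightarrow> ('a \<Rightarrow> 'a \<Rightarrow> 'a \<Rightarrow> 'a) \<Rightarrow> 'a \<Rightarrow> 'a \<Rightarrow> 'a \<Rightarrow> 'a" where
  "sum_bracket br1 br2 x y z = br1 x y z + br2 x y z"

end

theory Submission
  imports Defs
begin

text \<open>
  The averaging identity \<open>\<beta> [\<beta> x, \<beta> y, z] = [\<beta> x, \<beta> y, \<beta> z]\<close> says precisely that \<open>\<beta>\<close> carries the
  twisted bracket \<open>[\<beta> x, \<beta> y, z]\<close> to the original one. So \<open>\<beta>\<close> embeds \<open>L\<close> with its two twisted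
  brackets into \<open>L\<close> with its two original brackets, and every identity between linear combinations
  of iterated brackets, even one that mixes the two brackets, pulls back along this embedding. This
  applies to the Leibniz identity of each bracket (\<open>leibniz_reflected\<close>) and to the compatibility
  identity (\<open>compatible_reflected\<close>). Trilinearity is immediate, as the twisted bracket is the
  original one precomposed with linear maps.

  That \<open>\<beta>\<close> is a morphism for the sums of the brackets follows by adding the two averaging
  identities, once both sums are known to be ternary Leibniz brackets. This holds for the sum of any
  compatible pair (\<open>ternary_leibniz_sum\<close>): expanding the Leibniz identity of the sum gives the two
  pure identities and, as cross terms, the compatibility identity.
\<close>

lemma (in ternary_leibniz_algebra) bracket_add:
  shows "br (x + x') y z = br x y z + br x' y z"
    and "br x (y + y') z = br x y z + br x y' z"
    and "br x y (z + z') = br x y z + br x y z'"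
  using trilinear by (simp_all add: trilinear_def Vector_Spaces.linear_iff)

lemma trilinear_sum:
  assumes "trilinear scale br1" "trilinear scale br2"
  shows "trilinear scale (sum_bracket br1 br2)"
proof -
  have "vector_space scale"
    using assms(1) by (simp add: trilinear_def Vector_Spaces.linear_iff)
  then interpret vector_space scale .
  show ?thesis
    using assms
    by (simp add: trilinear_def sum_bracket_def Vector_Spaces.linear_iff scale_right_distrib add_ac)
qed

lemma trilinear_twisted:
  assumes "trilinear scale br" and "Vector_Spaces.linear scale scale \<beta>"
  shows "trilinear scale (twisted_bracket \<beta> br)"
  using assms unfolding trilinear_def twisted_bracket_def
  by (simp add: Vector_Spaces.linear_iff)

text \<open>
  Moving \<open>f\<close> inside both sides of the Leibniz identity for \<open>br'\<close> turns it into the identity for \<open>br\<close>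
  at the images of the five arguments, and injectivity then removes \<open>f\<close>.
\<close>

lemma leibniz_reflected:
  fixes f :: "'a::ab_group_add \<Rightarrow> 'b::ab_group_add"
  assumes "ternary_leibniz_algebra scale2 br" and "vector_space scale1"
    and "trilinear scale1 br'"
    and "inj f" and add: "\<And>x y. f (x + y) = f x + f y"
    and hom: "\<And>x y z. f (br' x y z) = br (f x) (f y) (f z)"
  shows "ternary_leibniz_algebra scale1 br'"
proof -
  interpret L: ternary_leibniz_algebra scale2 br by fact
  interpret vector_space scale1 by fact
  show ?thesis
  proof
    fix x y z t u
    have "f (br' (br' x y z) t u)
        = f (br' x y (br' z t u) + br' x (br' y t u) z + br' (br' x t u) y z)"
      by (simp only: add hom L.leibniz[of "f x" "f y" "f z" "f t" "f u"])
    then show "br' (br' x y z) t u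
        = br' x y (br' z t u) + br' x (br' y t u) z + br' (br' x t u) y z"
      by (rule injD[OF \<open>inj f\<close>])
  qed fact
qed

text \<open>
  The same argument works for the mixed identity, because a single map \<open>f\<close> respects both brackets.
\<close>

lemma compatible_reflected:
  fixes f :: "'a::ab_group_add \<Rightarrow> 'b::ab_group_add"
  assumes "compatible_ternary_leibniz_algebra scale2 br1 br2" and "vector_space scale1"
    and "trilinear scale1 br1'" and "trilinear scale1 br2'"
    and "inj f" and add: "\<And>x y. f (x + y) = f x + f y"
    and hom1: "\<And>x y z. f (br1' x y z) = br1 (f x) (f y) (f z)"
    and hom2: "\<And>x y z. f (br2' x y z) = br2 (f x) (f y) (f z)"
  shows "compatible_ternary_leibniz_algebra scale1 br1' br2'"
proof -
  interpret L: compatible_ternary_leibniz_algebra scale2 br1 br2 by fact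
  show ?thesis
  proof (intro compatible_ternary_leibniz_algebra.intro
      compatible_ternary_leibniz_algebra_axioms.intro)
    show "ternary_leibniz_algebra scale1 br1'"
      by (rule leibniz_reflected[where f = f, OF L.first.ternary_leibniz_algebra_axioms
            assms(2,3,5)])
        (rule add hom1)+
    show "ternary_leibniz_algebra scale1 br2'"
      by (rule leibniz_reflected[where f = f, OF L.second.ternary_leibniz_algebra_axioms
            assms(2,4,5)])
        (rule add hom2)+
  next
    fix x y z t u
    have "f (br2' (br1' x y z) t u + br1' (br2' x y z) t u)
        = f (br2' x y (br1' z t u) + br1' x y (br2' z t u) + br2' x (br1' y t u) z
          + br1' x (br2' y t u) z + br2' (br1' x t u) y z + br1' (br2' x t u) y z)"
      by (simp only: add hom1 hom2 L.compatible[of "f x" "f y" "f z" "f t" "f u"])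
    then show "br2' (br1' x y z) t u + br1' (br2' x y z) t u
        = br2' x y (br1' z t u) + br1' x y (br2' z t u) + br2' x (br1' y t u) z
          + br1' x (br2' y t u) z + br2' (br1' x t u) y z + br1' (br2' x t u) y z"
      by (rule injD[OF \<open>inj f\<close>])
  qed
qed

text \<open>
  Each term of the Leibniz identity is quadratic in the bracket, and the compatibility identity is
  the polarization of the Leibniz identity; hence the identity for the sum splits into the identities
  for the two summands and the compatibility identity.
\<close>

lemma ternary_leibniz_sum:
  assumes "compatible_ternary_leibniz_algebra scale br1 br2"
  shows "ternary_leibniz_algebra scale (sum_bracket br1 br2)"
proof -
  interpret compatible_ternary_leibniz_algebra scale br1 br2 by fact
  show ?thesis
  proof
    show "trilinear scale (sum_bracket br1 br2)"
      by (rule trilinear_sum[OF first.trilinear second.trilinear])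
  next
    fix x y z t u
    let ?b = "sum_bracket br1 br2"
    have "?b (?b x y z) t u = br1 (br1 x y z) t u + br2 (br2 x y z) t u
        + (br2 (br1 x y z) t u + br1 (br2 x y z) t u)"
      by (simp add: sum_bracket_def first.bracket_add second.bracket_add add_ac)
    also have "\<dots> = ?b x y (?b z t u) + ?b x (?b y t u) z + ?b (?b x t u) y z"
      unfolding first.leibniz[of x y z t u] second.leibniz[of x y z t u] compatible[of x y z t u]
      by (simp add: sum_bracket_def first.bracket_add second.bracket_add add_ac)
    finally show "?b (?b x y z) t u
        = ?b x y (?b z t u) + ?b x (?b y t u) z + ?b (?b x t u) y z" .
  qed
qed

theorem proposition2p9:
  fixes scale :: "'k::field \<Rightarrow> 'a::ab_group_add \<Rightarrow> 'a"
    and br1 br2 :: "'a \<Rightarrow> 'a \<Rightarrow> 'a \<Rightarrow> 'a"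
    and \<beta> :: "'a \<Rightarrow> 'a"
  assumes "compatible_ternary_leibniz_algebra scale br1 br2"
    and "averaging_operator scale br1 \<beta>"
    and "averaging_operator scale br2 \<beta>"
    and "inj \<beta>"
  shows "compatible_ternary_leibniz_algebra scale (twisted_bracket \<beta> br1) (twisted_bracket \<beta> br2) \<and>
    ternary_leibniz_morphism
      scale (sum_bracket (twisted_bracket \<beta> br1) (twisted_bracket \<beta> br2))
      scale (sum_bracket br1 br2)
      \<beta>"
proof -
  interpret A1: averaging_operator scale br1 \<beta> by fact
  interpret A2: averaging_operator scale br2 \<beta> by fact
  have hom1: "\<beta> (twisted_bracket \<beta> br1 x y z) = br1 (\<beta> x) (\<beta> y) (\<beta> z)" for x y z
    by (simp only: twisted_bracket_def A1.averaging12)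
  have hom2: "\<beta> (twisted_bracket \<beta> br2 x y z) = br2 (\<beta> x) (\<beta> y) (\<beta> z)" for x y z
    by (simp only: twisted_bracket_def A2.averaging12)
  have lin: "Vector_Spaces.linear scale scale \<beta>"
    by (rule A1.linear_axioms)
  have compat: "compatible_ternary_leibniz_algebra scale
      (twisted_bracket \<beta> br1) (twisted_bracket \<beta> br2)"
    using trilinear_twisted[OF A1.trilinear lin] trilinear_twisted[OF A2.trilinear lin]
    by (rule compatible_reflected[where f = \<beta>, OF assms(1) A1.vector_space_axioms _ _ assms(4)])
      (rule A1.add hom1 hom2)+
  have "\<beta> (sum_bracket (twisted_bracket \<beta> br1) (twisted_bracket \<beta> br2) x y z)
      = sum_bracket br1 br2 (\<beta> x) (\<beta> y) (\<beta> z)" for x y z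
    by (simp only: sum_bracket_def A1.add hom1 hom2)
  then have "ternary_leibniz_morphism
      scale (sum_bracket (twisted_bracket \<beta> br1) (twisted_bracket \<beta> br2))
      scale (sum_bracket br1 br2) \<beta>"
    by (intro ternary_leibniz_morphism.intro ternary_leibniz_morphism_axioms.intro
        ternary_leibniz_sum compat assms(1) lin)
  with compat show ?thesis ..
qed

end
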